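(* For every integer $n\ge 2$, the $n$-dominating graph $D_n(P_n)$ of the path $P_n$ has maximum degree $\Delta(D_n(P_n))=n$ and minimum degree $\delta(D_n(P_n))=n-\left\lceil\frac{n}{2}\right\rceil$.
   Context: $P_n$ is the path with vertex set $\{1,2,\dots,n\}$ and edge set $\{\{1,2\},\{2,3\},\dots,\{n-1,n\}\}$. A set $S\subseteq V(G)$ is a dominating set of a graph $G$ if every vertex of $V(G)\setminus S$ is adjacent to at least one vertex of $S$. The graph $D_n(P_n)$ has as vertices all dominating sets of $P_n$, two of them being adjacent if and only if one is obtained from the other by adding or deleting a single vertex (i.e. their symmetric difference has exactly one element). *)

theory Defs
  imports Complex_Main
begin

text \<open>A graph is a pair of a vertex set and a set of edges, each edge being a two-element
  set of vertices.\<close>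

type_synonym 'a graph = "'a set \<times> 'a set set"

definition verts :: "'a graph \<Rightarrow> 'a set" where
  "verts G = fst G"

definition edges :: "'a graph \<Rightarrow> 'a set set" where
  "edges G = snd G"

definition finite_simple_graph :: "'a graph \<Rightarrow> bool" where
  "finite_simple_graph G \<longleftrightarrow>
     finite (verts G) \<and> (\<forall>e\<in>edges G. e \<subseteq> verts G \<and> card e = 2)"

definition adjacent :: "'a graph \<Rightarrow> 'a \<Rightarrow> 'a \<Rightarrow> bool" where
  "adjacent G u v \<longleftrightarrow> {u, v} \<in> edges G"

definition degree :: "'a graph \<Rightarrow> 'a \<Rightarrow> nat" where
  "degree G v = card {u \<in> verts G. adjacent G v u}"

text \<open>The maximum and minimum degree are meaningful for graphs with a finite nonempty vertex set.\<close>

definition max_degree :: "'a graph \<Rightarrow> nat" where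
  "max_degree G = Max (degree G ` verts G)"

definition min_degree :: "'a graph \<Rightarrow> nat" where
  "min_degree G = Min (degree G ` verts G)"

definition dominating_set :: "'a graph \<Rightarrow> 'a set \<Rightarrow> bool" where
  "dominating_set G S \<longleftrightarrow>
     S \<subseteq> verts G \<and> (\<forall>v\<in>verts G - S. \<exists>u\<in>S. adjacent G v u)"

definition dominating_graph :: "'a graph \<Rightarrow> 'a set graph" where
  "dominating_graph G =
     ({S. dominating_set G S},
      {{S, T} | S T. dominating_set G S \<and> dominating_set G T \<and> card ((S - T) \<union> (T - S)) = 1})"

definition path_graph :: "nat \<Rightarrow> nat graph" where
  "path_graph n = ({1..n}, {{i, i + 1} | i. 1 \<le> i \<and> i + 1 \<le> n})"

lemma finite_simple_graph_path_graph: "finite_simple_graph (path_graph n)"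
  by (auto simp: finite_simple_graph_def path_graph_def verts_def edges_def)

lemma finite_simple_graph_dominating_graph:
  assumes "finite_simple_graph G"
  shows "finite_simple_graph (dominating_graph G)"
proof -
  have "finite {S. dominating_set G S}"
    by (rule finite_subset[of _ "Pow (verts G)"])
      (use assms in \<open>auto simp: dominating_set_def finite_simple_graph_def\<close>)
  moreover have "card {S, T} = 2" if "card ((S - T) \<union> (T - S)) = 1" for S T :: "'a set"
    using that by (cases "S = T") auto
  ultimately show ?thesis
    by (auto simp: finite_simple_graph_def dominating_graph_def verts_def edges_def)
qed

lemma verts_dominating_graph_nonempty: "verts (dominating_graph G) \<noteq> {}"
proof -
  have "dominating_set G (verts G)"
    by (simp add: dominating_set_def)
  then show ?thesis
    by (auto simp: dominating_graph_def verts_def)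
qed

lemma adjacent_dominating_graph_iff:
  "adjacent (dominating_graph G) S T \<longleftrightarrow>
     dominating_set G S \<and> dominating_set G T \<and> card ((S - T) \<union> (T - S)) = 1"
  by (auto simp: adjacent_def edges_def dominating_graph_def doubleton_eq_iff Un_commute)

end

theory Submission
  imports Defs
begin

text \<open>
  Adding a vertex to a dominating set always gives a dominating set, so the only vertices that
  cannot be toggled in a dominating set \<open>S\<close> are those elements whose removal destroys domination.
  Calling these critical, the degree of \<open>S\<close> in the dominating graph of \<open>G\<close> is the order of \<open>G\<close>
  minus the number of critical vertices (\<open>degree_dominating_graph\<close>), and the theorem asks how few
  and how many critical vertices \<open>S\<close> can have.

  The whole vertex set has none, because no vertex of the path is isolated when \<open>n \<ge> 2\<close>. For the
  other extreme, a critical vertex \<open>c\<close> owns a private neighbour: a vertex whose closed neighbourhood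
  meets \<open>S\<close> in \<open>c\<close> only. Since every edge of the path joins an odd and an even number, private
  neighbours can be used to push the even critical vertices injectively onto odd vertices that are
  not critical themselves (\<open>card_critical_path_le\<close>). Hence there are at most as many
  critical vertices as odd numbers up to \<open>n\<close>, that is \<open>\<lceil>n/2\<rceil>\<close>, and the set of all odd vertices,
  being both dominating and independent, attains this bound.
\<close>

section \<open>Degrees in the dominating graph\<close>

definition critical :: "'a graph \<Rightarrow> 'a set \<Rightarrow> 'a set" where
  "critical G S = {v \<in> S. \<not> dominating_set G (S - {v})}"

lemma dominating_set_insert:
  assumes "dominating_set G S" and "v \<in> verts G"
  shows "dominating_set G (insert v S)"
  using assms by (auto simp: dominating_set_def)

text \<open>Toggling a vertex recovers it as the symmetric difference with \<open>S\<close>, so the neighbours of \<open>S\<close>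
  are counted by the vertices whose toggling preserves domination, which are the non-critical ones.\<close>

lemma degree_dominating_graph:
  assumes fin: "finite (verts G)" and S: "dominating_set G S"
  shows "degree (dominating_graph G) S = card (verts G) - card (critical G S)"
proof -
  let ?t = "\<lambda>v. if v \<in> S then S - {v} else insert v S"
  have SV: "S \<subseteq> verts G"
    using S by (simp add: dominating_set_def)
  have diff: "(S - ?t v) \<union> (?t v - S) = {v}" for v
    by auto
  have inj: "inj_on ?t (verts G - critical G S)"
  proof (rule inj_onI)
    fix u v assume eq: "?t u = ?t v"
    have "{u} = (S - ?t u) \<union> (?t u - S)"
      by (rule diff[symmetric])
    also have "\<dots> = {v}"
      unfolding eq by (rule diff)
    finally show "u = v"
      by simp
  qed
  have "{T \<in> verts (dominating_graph G). adjacent (dominating_graph G) S T}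
      = ?t ` (verts G - critical G S)" (is "?N = ?t ` ?U")
  proof (intro equalityI subsetI)
    fix T assume "T \<in> ?N"
    then have T: "dominating_set G T" and "card ((S - T) \<union> (T - S)) = 1"
      by (auto simp: adjacent_dominating_graph_iff)
    then obtain v where v: "(S - T) \<union> (T - S) = {v}"
      by (auto simp: card_1_singleton_iff)
    have "x \<in> T \<longleftrightarrow> (x \<in> S \<longleftrightarrow> x \<noteq> v)" for x
      using eqset_imp_iff[OF v, of x] by auto
    then have Tv: "T = ?t v"
      by (intro set_eqI) auto
    have "v \<in> verts G"
      using v T SV by (auto simp: dominating_set_def)
    moreover have "v \<notin> critical G S"
      using T Tv by (auto simp: critical_def)
    ultimately show "T \<in> ?t ` ?U"
      using Tv by blast
  next
    fix T assume "T \<in> ?t ` ?U"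
    then obtain v where v: "v \<in> verts G" "v \<notin> critical G S" and Tv: "T = ?t v"
      by blast
    have T: "dominating_set G T"
      using v S dominating_set_insert[OF S] unfolding Tv critical_def by auto
    have "card ((S - T) \<union> (T - S)) = 1"
      unfolding Tv diff by simp
    with T S show "T \<in> ?N"
      by (simp add: adjacent_dominating_graph_iff) (simp add: verts_def dominating_graph_def)
  qed
  then have "degree (dominating_graph G) S = card ?U"
    by (simp only: degree_def card_image[OF inj])
  also have "critical G S \<subseteq> verts G"
    using SV by (auto simp: critical_def)
  then have "card ?U = card (verts G) - card (critical G S)"
    using fin by (simp add: card_Diff_subset finite_subset)
  finally show ?thesis .
qed

lemma critical_verts_empty:
  assumes "\<And>v. v \<in> verts G \<Longrightarrow> \<exists>u\<in>verts G. u \<noteq> v \<and> adjacent G v u"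
  shows "critical G (verts G) = {}"
  using assms by (fastforce simp: critical_def dominating_set_def)

text \<open>A vertex left undominated when \<open>c\<close> is removed was dominated by \<open>c\<close> alone.\<close>

lemma critical_private_neighbour:
  assumes S: "dominating_set G S" and c: "c \<in> critical G S"
  obtains w where "w \<in> verts G" and "w = c \<or> adjacent G w c"
    and "\<And>u. u \<in> S \<Longrightarrow> u = w \<or> adjacent G w u \<Longrightarrow> u = c"
proof -
  have "\<not> dominating_set G (S - {c})" "S \<subseteq> verts G"
    using S c by (auto simp: critical_def dominating_set_def)
  then obtain w where w: "w \<in> verts G" "w \<notin> S - {c}" "\<forall>u\<in>S - {c}. \<not> adjacent G w u"
    by (auto simp: dominating_set_def)
  have "w = c \<or> adjacent G w c"
    using S w by (auto simp: dominating_set_def)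
  moreover have "u = c" if "u \<in> S" "u = w \<or> adjacent G w u" for u
    using that w by auto
  ultimately show thesis
    using that w(1) by blast
qed

section \<open>Critical vertices in paths\<close>

lemma verts_path_graph: "verts (path_graph n) = {1..n}"
  by (simp add: path_graph_def verts_def)

lemma adjacent_path_graph_iff:
  "adjacent (path_graph n) u v \<longleftrightarrow>
     u \<in> {1..n} \<and> v \<in> {1..n} \<and> (v = Suc u \<or> u = Suc v)"
  by (auto simp: adjacent_def path_graph_def edges_def doubleton_eq_iff)

lemma card_odd_atMost: "card {v \<in> {1..n}. odd v} = (n + 1) div 2"
proof (induction n)
  case (Suc n)
  have "{v \<in> {1..Suc n}. odd v} =
      (if odd (Suc n) then insert (Suc n) {v \<in> {1..n}. odd v} else {v \<in> {1..n}. odd v})"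
    by (auto simp: le_Suc_eq)
  then show ?case
    using Suc by (cases "even n") simp_all
qed simp

text \<open>Odd critical vertices stay where they are. An even critical vertex goes to its private
  neighbour if that is odd; otherwise it is its own private neighbour, hence isolated in \<open>S\<close>, and
  goes to its left neighbour. A collision would place a second vertex of \<open>S\<close> into the closed
  neighbourhood of a private neighbour.\<close>

lemma card_critical_path_le:
  assumes S: "dominating_set (path_graph n) S"
  shows "card (critical (path_graph n) S) \<le> (n + 1) div 2"
proof -
  let ?G = "path_graph n"
  let ?C = "critical ?G S"
  have CS: "?C \<subseteq> S" and SV: "S \<subseteq> {1..n}"
    using S by (auto simp: critical_def dominating_set_def verts_path_graph)
  have "\<forall>c\<in>?C. \<exists>w. w \<in> {1..n} \<and> (w = c \<or> adjacent ?G w c) \<and>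
      (\<forall>u\<in>S. u = w \<or> adjacent ?G w u \<longrightarrow> u = c)"
    using critical_private_neighbour[OF S] by (metis verts_path_graph)
  then obtain w where w: "\<And>c. c \<in> ?C \<Longrightarrow> w c \<in> {1..n}"
      and near: "\<And>c. c \<in> ?C \<Longrightarrow> w c = c \<or> adjacent ?G (w c) c"
      and priv: "\<And>c u. c \<in> ?C \<Longrightarrow> u \<in> S \<Longrightarrow> u = w c \<or> adjacent ?G (w c) u \<Longrightarrow> u = c"
    by metis
  define f where "f c = (if odd c then c else if w c = c then c - 1 else w c)" for c
  have w_cases: "w c = c \<or> w c = Suc c \<or> c = Suc (w c)" if "c \<in> ?C" for c
    using near[OF that] by (auto simp: adjacent_path_graph_iff)
  have unique: "d = c" if "c \<in> ?C" "d \<in> ?C" "d = w c \<or> d = Suc (w c) \<or> w c = Suc d" for c d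
  proof -
    have "d \<in> S" "d \<in> {1..n}"
      using that(2) CS SV by auto
    then show ?thesis
      using priv[OF that(1), of d] w[OF that(1)] that(3) by (auto simp: adjacent_path_graph_iff)
  qed
  have pos: "c > 0" if "c \<in> ?C" for c
    using that CS SV by auto
  have "inj_on f ?C"
  proof (rule inj_onI)
    fix c d assume c: "c \<in> ?C" and d: "d \<in> ?C" and eq: "f c = f d"
    have "c = d \<or> \<not> (d = w c \<or> d = Suc (w c) \<or> w c = Suc d)"
      using unique[OF c d] by metis
    moreover have "c = d \<or> \<not> (c = w d \<or> c = Suc (w d) \<or> w d = Suc c)"
      using unique[OF d c] by metis
    ultimately show "c = d"
      using eq w_cases[OF c] w_cases[OF d] pos[OF c] pos[OF d]
      unfolding f_def by (simp split: if_splits) presburger+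
  qed
  moreover have "f ` ?C \<subseteq> {v \<in> {1..n}. odd v}"
  proof
    fix x assume "x \<in> f ` ?C"
    then obtain c where c: "c \<in> ?C" and x: "x = f c"
      by blast
    have "c \<in> {1..n}"
      using c CS SV by auto
    then show "x \<in> {v \<in> {1..n}. odd v}"
      using x w[OF c] w_cases[OF c] unfolding f_def by (auto split: if_splits elim!: evenE)
  qed
  ultimately have "card ?C \<le> card {v \<in> {1..n}. odd v}"
    by (intro card_inj_on_le) auto
  then show ?thesis
    by (simp only: card_odd_atMost)
qed

lemma dominating_set_odd_path: "dominating_set (path_graph n) {v \<in> {1..n}. odd v}"
proof -
  have "\<exists>u\<in>{v \<in> {1..n}. odd v}. adjacent (path_graph n) v u" if "v \<in> {1..n}" "even v" for v
    using that by (intro bexI[of _ "v - 1"]) (auto simp: adjacent_path_graph_iff elim!: evenE)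
  then show ?thesis
    by (auto simp: dominating_set_def verts_path_graph)
qed

text \<open>The odd vertices form an independent set, so each of them is dominated by no other of them.\<close>

lemma critical_odd_path:
  "critical (path_graph n) {v \<in> {1..n}. odd v} = {v \<in> {1..n}. odd v}"
  by (auto simp: critical_def dominating_set_def verts_path_graph adjacent_path_graph_iff)

theorem theorem9:
  fixes n :: nat
  assumes "n \<ge> 2"
  shows "max_degree (dominating_graph (path_graph n)) = n \<and>
         int (min_degree (dominating_graph (path_graph n))) = int n - \<lceil>real n / 2\<rceil>"
proof
  let ?G = "path_graph n" and ?D = "dominating_graph (path_graph n)"
  have fin: "finite (degree ?D ` verts ?D)"
    using finite_simple_graph_dominating_graph[OF finite_simple_graph_path_graph]
    by (auto simp: finite_simple_graph_def)
  have vertsD: "S \<in> verts ?D \<longleftrightarrow> dominating_set ?G S" for S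
    by (simp add: verts_def dominating_graph_def)
  have deg: "degree ?D S = n - card (critical ?G S)" if "dominating_set ?G S" for S
    using degree_dominating_graph[OF _ that] by (simp add: verts_path_graph)

  have full: "dominating_set ?G (verts ?G)"
    by (simp add: dominating_set_def)
  have "\<exists>u\<in>verts ?G. u \<noteq> v \<and> adjacent ?G v u" if "v \<in> verts ?G" for v
    using that assms
    by (intro bexI[of _ "if v = 1 then 2 else v - 1"])
       (auto simp: verts_path_graph adjacent_path_graph_iff)
  then have "degree ?D (verts ?G) = n"
    by (simp add: deg[OF full] critical_verts_empty)
  then have "n \<in> degree ?D ` verts ?D"
    using full vertsD by (metis imageI)
  then show "max_degree ?D = n"
    unfolding max_degree_def using fin by (intro Max_eqI) (auto simp: vertsD deg)

  have "degree ?D {v \<in> {1..n}. odd v} = n - (n + 1) div 2"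
    by (simp only: deg[OF dominating_set_odd_path] critical_odd_path card_odd_atMost)
  moreover have "{v \<in> {1..n}. odd v} \<in> verts ?D"
    by (simp only: vertsD dominating_set_odd_path)
  ultimately have "n - (n + 1) div 2 \<in> degree ?D ` verts ?D"
    by (rule image_eqI[OF sym])
  then have "min_degree ?D = n - (n + 1) div 2"
    unfolding min_degree_def using fin card_critical_path_le
    by (intro Min_eqI) (auto simp: vertsD deg intro!: diff_le_mono2)
  moreover have "\<lceil>real n / 2\<rceil> = int ((n + 1) div 2)"
    by (cases "even n") (auto elim!: evenE oddE intro!: ceiling_unique)
  ultimately show "int (min_degree ?D) = int n - \<lceil>real n / 2\<rceil>"
    by simp
qed

end
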